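(* Let $S$ be a class of (Borel) sets in $\mathbb{R}^d$ with growth function $m^S$ satisfying $m^S(\ell)\leqslant \ell^p+1$ for all $\ell\in\mathbb{N}$, for some $p>0$. For an i.i.d. sample from a probability distribution on $\mathbb{R}^d$, let $\pi^{(\ell)}$ be the maximal (supremal) deviation over the sets in $S$ between relative frequency in the first $\ell$ observations and probability. For $\varepsilon>0$ let $\mathcal{O}_\varepsilon:=\sum_{\ell=1}^\infty\mathbf{1}\{\pi^{(\ell)}>\varepsilon\}$. For any $\varepsilon,\delta>0$ set $$\Lambda_{\varepsilon,\delta}(N):=\frac{e^{\varepsilon^2N/8}}{N^{1+\delta}\,m^S(2N)},\quad N\in\mathbb{N},\qquad \Lambda_{\varepsilon,\delta}(0):=0.$$ Then $\pi^{(\ell)}\to0$ almost surely as $\ell\to\infty$ and, for any $\varepsilon,\delta>0$, $$\mathbb{E}[\Lambda_{\varepsilon,\delta}(\mathcal{O}_\varepsilon)]<\infty .$$ In particular, for any $\varepsilon,\delta>0$ there is a constant $C>0$ such that $\mathbb{P}(\mathcal{O}_\varepsilon\geqslant k)\leqslant C/\Lambda_{\varepsilon,\delta}(k)$ for all $k\in\mathbb{N}$.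
   Context: $\mathbb{N}=\{1,2,\dots\}$. Let $(X_i)_{i\in\mathbb{N}}$ be i.i.d. with values in $\mathbb{R}^d$ and common law $\mu$. For $\ell\in\mathbb{N}$, $\pi^{(\ell)}:=\sup_{A\in S}\big|\frac1\ell\sum_{i=1}^\ell\mathbf{1}\{X_i\in A\}-\mu(A)\big|$, assumed measurable (a random variable). The growth function (called index) of $S$ is $m^S(r):=\max_{x_1,\dots,x_r\in\mathbb{R}^d}\#\{A\cap\{x_1,\dots,x_r\}: A\in S\}$, $r\in\mathbb{N}$. The classical Vapnik–Chervonenkis inequality states that $\mathbb{P}(\pi^{(\ell)}>\varepsilon)\leqslant 4\,m^S(2\ell)\,e^{-\varepsilon^2\ell/8}$ for all $\ell\geqslant 2/\varepsilon^2$.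
   Formalization: Also assumed: S is nonempty, and the supremal deviation between the two halves of a 2ℓ-sample is measurable for the completed product law; with only π^(ℓ) measurable the claim fails under CH (initial segments of a well-ordering of the reals of type ω₁). *)

theory Defs
  imports "HOL-Probability.Probability"
begin

text \<open>Samples are indexed from 1: the first \<open>l\<close> observations are \<open>x 1, \<dots>, x l\<close>.\<close>

definition rel_freq :: "(nat \<Rightarrow> 'v) \<Rightarrow> nat \<Rightarrow> 'v set \<Rightarrow> real" where
  "rel_freq x l A = (\<Sum>i=1..l. indicator A (x i)) / real l"

definition max_dev :: "'v measure \<Rightarrow> 'v set set \<Rightarrow> nat \<Rightarrow> (nat \<Rightarrow> 'v) \<Rightarrow> real" where
  "max_dev \<mu> S l x = (SUP A\<in>S. \<bar>rel_freq x l A - measure \<mu> A\<bar>)"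

text \<open>
  The maximal deviation between the relative frequencies in the two halves of a sample of
  size \<open>2 * l\<close>. It serves only to express the measurability condition under which the
  Vapnik--Chervonenkis inequality holds. Measurability of the one-sample deviations alone is not
  enough: under the continuum hypothesis let \<open>S\<close> consist of the initial segments of a
  well-ordering of the reals of type \<open>\<omega>\<^sub>1\<close>. These are countable and the growth function
  is \<open>r + 1\<close>, but for an atomless law the one-sample deviation is constantly 1.
\<close>

definition two_sample_dev :: "'v set set \<Rightarrow> nat \<Rightarrow> (nat \<Rightarrow> 'v) \<Rightarrow> real" where
  "two_sample_dev S l x = (SUP A\<in>S. \<bar>rel_freq x l A - rel_freq (\<lambda>i. x (l + i)) l A\<bar>)"

definition growth :: "'v set set \<Rightarrow> nat \<Rightarrow> nat" where
  "growth S r = Max (range (\<lambda>x :: nat \<Rightarrow> 'v. card ((\<lambda>A. A \<inter> x ` {1..r}) ` S)))"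

text \<open>For a sequence of deviations \<open>d 1, d 2, \<dots>\<close>; the series always converges in \<open>enat\<close>.\<close>

definition num_exceed :: "real \<Rightarrow> (nat \<Rightarrow> real) \<Rightarrow> enat" where
  "num_exceed \<epsilon> d = (\<Sum>l. if d (Suc l) > \<epsilon> then 1 else 0)"

definition \<Lambda> :: "'v set set \<Rightarrow> real \<Rightarrow> real \<Rightarrow> nat \<Rightarrow> real" where
  "\<Lambda> S \<epsilon> \<delta> N =
     (if N = 0 then 0
      else exp (\<epsilon>\<^sup>2 * real N / 8) / (real N powr (1 + \<delta>) * real (growth S (2 * N))))"

text \<open>
  The value at infinity is the limit of \<open>\<Lambda>\<close> for growth functions of polynomial order, so that a
  finite expectation also entails that the number of exceedances is almost surely finite.
\<close>

definition \<Lambda>_ext :: "'v set set \<Rightarrow> real \<Rightarrow> real \<Rightarrow> enat \<Rightarrow> ennreal" where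
  "\<Lambda>_ext S \<epsilon> \<delta> n = (case n of enat N \<Rightarrow> ennreal (\<Lambda> S \<epsilon> \<delta> N) | \<infinity> \<Rightarrow> \<infinity>)"

end

theory Submission
  imports Defs "HOL-Real_Asymp.Real_Asymp"
begin

text \<open>
  Two estimates carry the theorem. The first is the Vapnik--Chervonenkis inequality
  \<open>P(d\<^sub>l > \<epsilon>) \<le> 4 * m(2 * l) * exp (- \<epsilon>\<^sup>2 * l / 8)\<close>, where \<open>d\<^sub>l\<close> is the maximal deviation of the
  first \<open>l\<close> observations and \<open>m\<close> is the growth function
  (\<open>Vapnik_Chervonenkis_inequality\<close>). Its proof compares the sample with an independent ghost
  sample of the same size (\<open>symmetrization\<close>): if some set deviates by more than \<open>\<epsilon>\<close> on the
  sample and \<open>l * \<epsilon>\<^sup>2 \<ge> 3\<close>, then with probability at least one half its frequencies in the two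
  samples differ by more than \<open>\<epsilon> / 2\<close>; for smaller \<open>l\<close> the bound exceeds one. The law of the double sample does not change when observations are exchanged
  between the halves, so the exchanges may be randomised. With the double sample fixed, the classes
  of sets with the same trace on it number at most \<open>m(2 * l)\<close>, and the difference of the two
  relative frequencies for one trace is a mean of \<open>l\<close> terms in \<open>[-1, 1]\<close> with random signs, which
  exceeds \<open>\<epsilon> / 2\<close> in modulus with probability at most \<open>2 * exp (- l * \<epsilon>\<^sup>2 / 8)\<close>
  (\<open>card_swaps_two_sample_dev_gt\<close>, \<open>measure_two_sample_dev_le\<close>).

  The second estimate transfers this bound to the number of exceedances. At least \<open>k\<close> exceedances
  force one with an index \<open>l \<ge> k\<close>, so their probability is at most the tail from \<open>k\<close> on of the
  series of these bounds. As \<open>m(a + b) \<le> m(a) * m(b)\<close> (\<open>growth_add_le\<close>), this tail is at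
  most \<open>C * m(2 * k) * exp (- \<epsilon>\<^sup>2 * k / 8)\<close>, where \<open>C\<close> is the sum of the whole series, which is finite
  because \<open>m\<close> grows polynomially (\<open>prob_exceeds_after_le\<close>). By the choice of \<open>\<Lambda>\<close> the latter is
  \<open>C / (k powr (1 + \<delta>) * \<Lambda>(k))\<close>. So the tail bound holds, and the expectation of \<open>\<Lambda>\<close> at the number
  of exceedances is at most the sum over \<open>k \<ge> 1\<close> of \<open>\<Lambda>(k)\<close> times the probability of an exceedance
  with index at least \<open>k\<close>, hence at most \<open>C\<close> times the sum of \<open>1 / k powr (1 + \<delta>)\<close>. The almost
  sure convergence follows from the first estimate and the Borel--Cantelli lemma.
\<close>

section \<open>The growth function\<close>

lemma finite_traces: "finite ((\<lambda>A. A \<inter> x ` {1..r::nat}) ` S)"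
  by (rule finite_subset[of _ "Pow (x ` {1..r})"]) auto

lemma card_traces_le_power: "card ((\<lambda>A. A \<inter> x ` {1..r::nat}) ` S) \<le> 2 ^ r"
proof -
  have "card ((\<lambda>A. A \<inter> x ` {1..r}) ` S) \<le> card (Pow (x ` {1..r}))"
    by (rule card_mono) auto
  also have "\<dots> = 2 ^ card (x ` {1..r})"
    by (simp add: card_Pow)
  also have "\<dots> \<le> 2 ^ r"
    using card_image_le[of "{1..r}" x] by (intro power_increasing) auto
  finally show ?thesis .
qed

lemma finite_range_card_traces:
  "finite (range (\<lambda>x :: nat \<Rightarrow> 'v. card ((\<lambda>A. A \<inter> x ` {1..r::nat}) ` S)))"
  by (rule finite_subset[of _ "{..2 ^ r}"]) (use card_traces_le_power in auto)

lemma card_traces_le_growth: "card ((\<lambda>A. A \<inter> x ` {1..r}) ` S) \<le> growth S r"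
  unfolding growth_def by (rule Max_ge[OF finite_range_card_traces]) auto

lemma growth_attained: "\<exists>x. growth S r = card ((\<lambda>A. A \<inter> x ` {1..r}) ` S)"
  using Max_in[OF finite_range_card_traces[of r S]] unfolding growth_def by auto

lemma growth_pos:
  assumes "S \<noteq> {}"
  shows "growth S r > 0"
proof -
  have "card ((\<lambda>A. A \<inter> undefined ` {1..r}) ` S) > 0"
    using assms finite_traces[of undefined r S] by (simp add: card_gt_0_iff)
  then show ?thesis
    using card_traces_le_growth[of undefined r S] by linarith
qed

text \<open>
  The trace of a set on \<open>a + b\<close> points is determined by its traces on the first \<open>a\<close> and on the
  last \<open>b\<close> of them. This is what lets the tail of the series of Vapnik--Chervonenkis bounds be
  compared with its first term.
\<close>

lemma growth_add_le: "growth S (a + b) \<le> growth S a * growth S b"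
proof -
  obtain x where x: "growth S (a + b) = card ((\<lambda>A. A \<inter> x ` {1..a + b}) ` S)"
    using growth_attained by blast
  define y where "y = (\<lambda>i. x (a + i))"
  define F where "F = (\<lambda>A. A \<inter> x ` {1..a}) ` S"
  define G where "G = (\<lambda>A. A \<inter> y ` {1..b}) ` S"
  have "y ` {1..b} = x ` ((+) a ` {1..b})"
    by (simp only: y_def image_image)
  moreover have "{1..a + b} = {1..a} \<union> (+) a ` {1..b}"
    by (auto simp: image_add_atLeastAtMost)
  ultimately have un: "x ` {1..a + b} = x ` {1..a} \<union> y ` {1..b}"
    by (simp add: image_Un)
  have "(\<lambda>A. A \<inter> x ` {1..a + b}) ` S \<subseteq> (\<lambda>(B, C). B \<union> C) ` (F \<times> G)"
    unfolding un F_def G_def by (auto simp: Int_Un_distrib)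
  then have "growth S (a + b) \<le> card ((\<lambda>(B, C). B \<union> C) ` (F \<times> G))"
    unfolding x by (intro card_mono finite_imageI finite_cartesian_product)
      (auto simp: F_def G_def intro: finite_traces[simplified])
  also have "\<dots> \<le> card (F \<times> G)"
    by (intro card_image_le finite_cartesian_product) (auto simp: F_def G_def intro: finite_traces[simplified])
  also have "\<dots> = card F * card G"
    by (simp add: card_cartesian_product)
  also have "\<dots> \<le> growth S a * growth S b"
    unfolding F_def G_def by (intro mult_mono card_traces_le_growth) auto
  finally show ?thesis .
qed

section \<open>Random signs\<close>

text \<open>
  The exponential moment of a random sign. As \<open>exp x * cosh x\<close> is the mean of \<open>exp\<close> over the two
  points \<open>0\<close> and \<open>2 * x\<close>, the bound is the symmetric case of Hoeffding's lemma.
\<close>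

lemma cosh_le_exp_half_square: "cosh (x :: real) \<le> exp (x\<^sup>2 / 2)"
proof -
  have *: "cosh x \<le> exp (x\<^sup>2 / 2)" if "x \<ge> 0" for x :: real
  proof -
    have "- (2 * x) * (1 / 2) + ln (1 + 1 / 2 * (exp (2 * x) - 1)) \<le> (2 * x)\<^sup>2 / 8"
      using that by (intro Hoeffdings_lemma_aux) auto
    then have bound: "- x + ln ((1 + exp (2 * x)) / 2) \<le> x\<^sup>2 / 2"
      by (simp add: field_simps)
    have "exp (- x) * exp (2 * x) = exp x"
      by (simp flip: exp_add)
    then have "cosh x = exp (- x) * ((1 + exp (2 * x)) / 2)"
      by (simp add: cosh_def distrib_left)
    also have "\<dots> = exp (- x + ln ((1 + exp (2 * x)) / 2))"
      by (simp only: exp_add, subst exp_ln) (auto simp: add_pos_pos)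
    also have "\<dots> \<le> exp (x\<^sup>2 / 2)"
      using bound by simp
    finally show ?thesis .
  qed
  show ?thesis
    using *[of x] *[of "- x"] by (cases "x \<ge> 0") auto
qed

text \<open>A choice of signs on \<open>I\<close> is encoded by the set \<open>J\<close> of indices that carry a minus sign.\<close>

definition signed_sum :: "'i set \<Rightarrow> ('i \<Rightarrow> real) \<Rightarrow> 'i set \<Rightarrow> real" where
  "signed_sum I a J = (\<Sum>i\<in>I. if i \<in> J then - a i else a i)"

lemma sum_exp_signed_sum:
  assumes "finite I"
  shows "(\<Sum>J\<in>Pow I. exp (s * signed_sum I a J)) = (\<Prod>i\<in>I. 2 * cosh (s * a i))"
proof -
  have "exp (s * signed_sum I a J) = (\<Prod>i\<in>J. exp (- (s * a i))) * (\<Prod>i\<in>I - J. exp (s * a i))"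
    if "J \<subseteq> I" for J
  proof -
    have "I \<inter> J = J" "I \<inter> - J = I - J"
      using that by auto
    then have "signed_sum I a J = (\<Sum>i\<in>J. - a i) + (\<Sum>i\<in>I - J. a i)"
      using assms by (simp add: signed_sum_def sum.If_cases)
    then have "s * signed_sum I a J = (\<Sum>i\<in>J. - (s * a i)) + (\<Sum>i\<in>I - J. s * a i)"
      by (simp add: distrib_left sum_distrib_left sum_negf right_diff_distrib)
    then show ?thesis
      using assms finite_subset[OF that assms] by (simp only: exp_add exp_sum finite_Diff)
  qed
  then have "(\<Sum>J\<in>Pow I. exp (s * signed_sum I a J)) = (\<Prod>i\<in>I. exp (- (s * a i)) + exp (s * a i))"
    by (subst prod_add[OF assms]) (auto intro!: sum.cong)
  then show ?thesis
    by (simp add: cosh_def add_ac mult.commute[of 2] add_divide_distrib)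
qed

text \<open>
  Chernoff's bound. The parameter \<open>s\<close> of the exponential moment is taken to be \<open>t\<close>, which
  minimises the resulting exponent \<open>n * s\<^sup>2 / 2 - n * s * t\<close>, where \<open>n = card I\<close>.
\<close>

lemma card_signed_sum_ge:
  assumes "finite I" "\<And>i. i \<in> I \<Longrightarrow> \<bar>a i\<bar> \<le> 1" "t \<ge> 0"
  shows "real (card {J \<in> Pow I. signed_sum I a J \<ge> real (card I) * t})
    \<le> 2 ^ card I * exp (- (real (card I) * t\<^sup>2 / 2))"
proof -
  define n where "n = card I"
  define E where "E = {J \<in> Pow I. signed_sum I a J \<ge> real n * t}"
  have "real (card E) * exp (real n * t\<^sup>2) = (\<Sum>J\<in>E. exp (real n * t\<^sup>2))"
    by simp
  also have "\<dots> \<le> (\<Sum>J\<in>E. exp (t * signed_sum I a J))"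
  proof (rule sum_mono)
    fix J assume "J \<in> E"
    then have "t * (real n * t) \<le> t * signed_sum I a J"
      using \<open>t \<ge> 0\<close> by (intro mult_left_mono) (auto simp: E_def)
    then show "exp (real n * t\<^sup>2) \<le> exp (t * signed_sum I a J)"
      by (simp add: power2_eq_square mult.left_commute)
  qed
  also have "\<dots> \<le> (\<Sum>J\<in>Pow I. exp (t * signed_sum I a J))"
    using assms(1) by (intro sum_mono2) (auto simp: E_def)
  also have "\<dots> = (\<Prod>i\<in>I. 2 * cosh (t * a i))"
    by (rule sum_exp_signed_sum) fact
  also have "\<dots> \<le> (\<Prod>i\<in>I. 2 * exp (t\<^sup>2 / 2))"
  proof (intro prod_mono conjI mult_left_mono)
    fix i assume "i \<in> I"
    then have "(a i)\<^sup>2 \<le> 1"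
      using assms(2) by (simp add: abs_square_le_1)
    then have "(t * a i)\<^sup>2 \<le> t\<^sup>2"
      by (simp add: power_mult_distrib mult_left_le)
    then show "cosh (t * a i) \<le> exp (t\<^sup>2 / 2)"
      using cosh_le_exp_half_square[of "t * a i"] by (meson divide_right_mono exp_le_cancel_iff order_trans zero_le_numeral)
  qed auto
  also have "\<dots> = 2 ^ n * exp (real n * t\<^sup>2 / 2)"
    by (simp add: n_def power_mult_distrib exp_of_nat_mult[symmetric])
  also have "\<dots> = 2 ^ n * exp (- (real n * t\<^sup>2 / 2)) * exp (real n * t\<^sup>2)"
    by (simp only: mult.assoc exp_add[symmetric]) simp
  finally have "real (card E) \<le> 2 ^ n * exp (- (real n * t\<^sup>2 / 2))"
    by (rule mult_right_le_imp_le) simp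
  then show ?thesis
    by (simp only: E_def n_def)
qed

corollary card_abs_signed_sum_ge:
  assumes "finite I" "\<And>i. i \<in> I \<Longrightarrow> \<bar>a i\<bar> \<le> 1" "t \<ge> 0"
  shows "real (card {J \<in> Pow I. \<bar>signed_sum I a J\<bar> \<ge> real (card I) * t})
    \<le> 2 * 2 ^ card I * exp (- (real (card I) * t\<^sup>2 / 2))"
proof -
  let ?E = "\<lambda>a. {J \<in> Pow I. signed_sum I a J \<ge> real (card I) * t}"
  have neg: "signed_sum I (\<lambda>i. - a i) J = - signed_sum I a J" for J
    by (auto simp: signed_sum_def sum_negf[symmetric] intro!: sum.cong)
  have "{J \<in> Pow I. \<bar>signed_sum I a J\<bar> \<ge> real (card I) * t} = ?E a \<union> ?E (\<lambda>i. - a i)"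
    unfolding neg by auto
  then have "real (card {J \<in> Pow I. \<bar>signed_sum I a J\<bar> \<ge> real (card I) * t})
    \<le> real (card (?E a)) + real (card (?E (\<lambda>i. - a i)))"
    using card_Un_le[of "?E a" "?E (\<lambda>i. - a i)"] by (simp only: of_nat_add[symmetric] of_nat_le_iff)
  also have "\<dots> \<le> 2 * (2 ^ card I * exp (- (real (card I) * t\<^sup>2 / 2)))"
    using card_signed_sum_ge[of I a t] card_signed_sum_ge[of I "\<lambda>i. - a i" t] assms by simp
  finally show ?thesis by simp
qed

section \<open>Exchanging the two halves of a double sample\<close>

text \<open>
  The permutation of \<open>{1..2 * l}\<close> that exchanges \<open>i\<close> with its partner \<open>l + i\<close> in the other half
  for every \<open>i \<in> J\<close>, where \<open>J \<subseteq> {1..l}\<close>.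
\<close>

definition swap_halves :: "nat \<Rightarrow> nat set \<Rightarrow> nat \<Rightarrow> nat" where
  "swap_halves l J i = (if i \<in> J then l + i else if l < i \<and> i - l \<in> J then i - l else i)"

lemma swap_halves_in: "J \<subseteq> {1..l} \<Longrightarrow> i \<in> {1..2 * l} \<Longrightarrow> swap_halves l J i \<in> {1..2 * l}"
  by (auto simp: swap_halves_def)

lemma swap_halves_involution: "J \<subseteq> {1..l} \<Longrightarrow> i \<in> {1..2 * l} \<Longrightarrow> swap_halves l J (swap_halves l J i) = i"
  by (auto simp: swap_halves_def)

lemma inj_on_swap_halves: "J \<subseteq> {1..l} \<Longrightarrow> inj_on (swap_halves l J) {1..2 * l}"
  by (rule inj_on_inverseI[of _ "swap_halves l J"]) (rule swap_halves_involution)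

lemma rel_freq_cong:
  assumes "\<And>i. i \<in> {1..l} \<Longrightarrow> x i \<in> A \<longleftrightarrow> y i \<in> B"
  shows "rel_freq x l A = rel_freq y l B"
  using assms unfolding rel_freq_def by (intro arg_cong2[where f = "(/)"] sum.cong) (auto simp: indicator_def)

lemma rel_freq_bounds: "0 \<le> rel_freq x l A" "rel_freq x l A \<le> 1"
proof -
  have "(\<Sum>i=1..l. indicator A (x i) :: real) \<le> (\<Sum>i=1..l. 1)"
    by (intro sum_mono) (auto simp: indicator_def)
  then show "rel_freq x l A \<le> 1"
    by (auto simp: rel_freq_def divide_le_eq_1)
  show "0 \<le> rel_freq x l A"
    unfolding rel_freq_def by (intro divide_nonneg_nonneg sum_nonneg) auto
qed

lemma max_dev_gt_iff:
  assumes "prob_space \<mu>" "S \<noteq> {}"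
  shows "max_dev \<mu> S l x > t \<longleftrightarrow> (\<exists>A\<in>S. \<bar>rel_freq x l A - measure \<mu> A\<bar> > t)"
proof -
  interpret prob_space \<mu> by fact
  have "bdd_above ((\<lambda>A. \<bar>rel_freq x l A - measure \<mu> A\<bar>) ` S)"
  proof (rule bdd_aboveI2)
    fix A show "\<bar>rel_freq x l A - measure \<mu> A\<bar> \<le> 1"
      using rel_freq_bounds[of x l A] prob_le_1[of A] measure_nonneg[of \<mu> A] by linarith
  qed
  then show ?thesis
    unfolding max_dev_def using assms(2) by (subst less_cSUP_iff) auto
qed

lemma max_dev_nonneg:
  assumes "prob_space \<mu>" "S \<noteq> {}"
  shows "max_dev \<mu> S l x \<ge> 0"
proof (rule dense_le)
  fix t :: real assume "t < 0"
  moreover obtain A where "A \<in> S"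
    using assms(2) by blast
  ultimately have "max_dev \<mu> S l x > t"
    using max_dev_gt_iff[OF assms] by (meson abs_ge_zero less_le_trans)
  then show "t \<le> max_dev \<mu> S l x" by simp
qed

lemma two_sample_dev_gt_iff:
  assumes "S \<noteq> {}"
  shows "two_sample_dev S l x > t \<longleftrightarrow> (\<exists>A\<in>S. \<bar>rel_freq x l A - rel_freq (\<lambda>i. x (l + i)) l A\<bar> > t)"
proof -
  have "bdd_above ((\<lambda>A. \<bar>rel_freq x l A - rel_freq (\<lambda>i. x (l + i)) l A\<bar>) ` S)"
  proof (rule bdd_aboveI2)
    fix A show "\<bar>rel_freq x l A - rel_freq (\<lambda>i. x (l + i)) l A\<bar> \<le> 1"
      using rel_freq_bounds[of x l A] rel_freq_bounds[of "\<lambda>i. x (l + i)" l A] by linarith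
  qed
  then show ?thesis
    unfolding two_sample_dev_def using assms by (subst less_cSUP_iff) auto
qed

lemma two_sample_dev_cong:
  assumes "\<And>i. i \<in> {1..2 * l} \<Longrightarrow> x i = y i"
  shows "two_sample_dev S l x = two_sample_dev S l y"
proof -
  have "rel_freq x l A = rel_freq y l A" for A
    using assms by (intro rel_freq_cong) auto
  moreover have "rel_freq (\<lambda>i. x (l + i)) l A = rel_freq (\<lambda>i. y (l + i)) l A" for A
    using assms by (intro rel_freq_cong) auto
  ultimately show ?thesis
    by (simp add: two_sample_dev_def)
qed

lemma rel_freq_diff_swap_halves:
  assumes "J \<subseteq> {1..l}"
  shows "rel_freq (\<lambda>i. x (swap_halves l J i)) l A - rel_freq (\<lambda>i. x (swap_halves l J (l + i))) l A
    = signed_sum {1..l} (\<lambda>i. indicator A (x i) - indicator A (x (l + i))) J / real l"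
  using assms unfolding rel_freq_def signed_sum_def diff_divide_distrib[symmetric] sum_subtractf[symmetric]
  by (intro arg_cong2[where f = "(/)"] sum.cong refl) (auto simp: swap_halves_def)

text \<open>
  For a fixed double sample, the deviation of a set between the two halves depends only on the
  trace of that set on the sample, however the halves are exchanged. So the union bound runs over
  at most \<open>growth S (2 * l)\<close> traces, each of which contributes a sum with random signs.
\<close>

lemma card_swaps_two_sample_dev_gt:
  assumes "S \<noteq> {}" "l \<ge> 1" "t \<ge> 0"
  shows "real (card {J \<in> Pow {1..l}. two_sample_dev S l (\<lambda>i. x (swap_halves l J i)) > t})
    \<le> real (growth S (2 * l)) * (2 * 2 ^ l * exp (- (real l * t\<^sup>2 / 2)))"
proof -
  define T where "T = (\<lambda>A. A \<inter> x ` {1..2 * l}) ` S"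
  define a where "a B i = (indicator B (x i) - indicator B (x (l + i)) :: real)" for B and i :: nat
  define bad where "bad B = {J \<in> Pow {1..l}. \<bar>signed_sum {1..l} (a B) J\<bar> \<ge> real (card {1..l}) * t}"
    for B
  have "finite T"
    unfolding T_def by (rule finite_traces)
  have fin: "finite (bad B)" for B
    by (rule finite_subset[of _ "Pow {1..l}"]) (auto simp: bad_def)
  have "{J \<in> Pow {1..l}. two_sample_dev S l (\<lambda>i. x (swap_halves l J i)) > t} \<subseteq> (\<Union>B\<in>T. bad B)"
  proof clarify
    fix J assume J: "J \<subseteq> {1..l}" and "t < two_sample_dev S l (\<lambda>i. x (swap_halves l J i))"
    then obtain A where A: "A \<in> S"
      and dev: "t < \<bar>rel_freq (\<lambda>i. x (swap_halves l J i)) l A - rel_freq (\<lambda>i. x (swap_halves l J (l + i))) l A\<bar>"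
      using two_sample_dev_gt_iff[OF assms(1)] by blast
    define B where "B = A \<inter> x ` {1..2 * l}"
    have "signed_sum {1..l} (a A) J = signed_sum {1..l} (a B) J"
      unfolding signed_sum_def a_def B_def by (intro sum.cong) (auto simp: indicator_def)
    then have "t < \<bar>signed_sum {1..l} (a B) J\<bar> / real l"
      using dev unfolding rel_freq_diff_swap_halves[OF J] a_def by simp
    then have "real l * t < \<bar>signed_sum {1..l} (a B) J\<bar>"
      using \<open>l \<ge> 1\<close> by (simp add: field_simps)
    then have "J \<in> bad B"
      using J by (simp add: bad_def)
    moreover have "B \<in> T"
      using A by (auto simp: B_def T_def)
    ultimately show "J \<in> (\<Union>B\<in>T. bad B)" by blast
  qed
  then have "card {J \<in> Pow {1..l}. two_sample_dev S l (\<lambda>i. x (swap_halves l J i)) > t} \<le> card (\<Union>B\<in>T. bad B)"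
    using \<open>finite T\<close> fin by (intro card_mono) auto
  also have "\<dots> \<le> (\<Sum>B\<in>T. card (bad B))"
    by (rule card_UN_le) fact
  finally have "real (card {J \<in> Pow {1..l}. two_sample_dev S l (\<lambda>i. x (swap_halves l J i)) > t})
    \<le> (\<Sum>B\<in>T. real (card (bad B)))"
    by (simp flip: of_nat_sum)
  also have "\<dots> \<le> (\<Sum>B\<in>T. 2 * 2 ^ l * exp (- (real l * t\<^sup>2 / 2)))"
  proof (rule sum_mono)
    fix B
    show "real (card (bad B)) \<le> 2 * 2 ^ l * exp (- (real l * t\<^sup>2 / 2))"
      using card_abs_signed_sum_ge[of "{1..l}" "a B" t] \<open>t \<ge> 0\<close>
      by (auto simp: bad_def a_def indicator_def)
  qed
  also have "\<dots> = real (card T) * (2 * 2 ^ l * exp (- (real l * t\<^sup>2 / 2)))"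
    by simp
  also have "\<dots> \<le> real (growth S (2 * l)) * (2 * 2 ^ l * exp (- (real l * t\<^sup>2 / 2)))"
    using card_traces_le_growth[of x "2 * l" S] by (intro mult_right_mono) (auto simp: T_def)
  finally show ?thesis .
qed

section \<open>The Vapnik--Chervonenkis inequality\<close>

text \<open>
  Exchanging partners preserves the law of the double sample, so the probability of \<open>D\<close> is the
  mean, over all \<open>2 ^ l\<close> exchanges, of the probabilities that the exchanged sample lies in \<open>D\<close>.
  Averaging over the exchanges before integrating leaves a bound that is uniform in the sample.
\<close>

lemma measure_two_sample_dev_le:
  fixes \<mu> :: "'v measure"
  assumes "prob_space \<mu>" "S \<noteq> {}" "l \<ge> 1" "t \<ge> 0"
    and D: "D \<in> sets (Pi\<^sub>M {1..2 * l} (\<lambda>_. \<mu>))" "\<And>x. x \<in> D \<Longrightarrow> two_sample_dev S l x > t"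
  shows "measure (Pi\<^sub>M {1..2 * l} (\<lambda>_. \<mu>)) D
    \<le> 2 * real (growth S (2 * l)) * exp (- (real l * t\<^sup>2 / 2))"
proof -
  define Q where "Q = Pi\<^sub>M {1..2 * l} (\<lambda>_. \<mu>)"
  define c where "c = real (growth S (2 * l)) * (2 * 2 ^ l * exp (- (real l * t\<^sup>2 / 2)))"
  define T where "T J x = (\<lambda>i\<in>{1..2 * l}. x (swap_halves l J i))" for J and x :: "nat \<Rightarrow> 'v"
  interpret Q: prob_space Q
    unfolding Q_def by (intro prob_space_PiM assms(1))
  have [measurable]: "D \<in> sets Q"
    using D(1) by (simp add: Q_def)
  have T: "T J \<in> measurable Q Q" "distr Q Q (T J) = Q" if "J \<in> Pow {1..l}" for J
  proof -
    show "T J \<in> measurable Q Q"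
      unfolding T_def Q_def using that swap_halves_in[of J l]
      by (intro measurable_restrict measurable_component_singleton) auto
    show "distr Q Q (T J) = Q"
      unfolding T_def Q_def using that swap_halves_in[of J l] inj_on_swap_halves[of J l] assms(1)
      by (intro distr_PiM_reindex[where M = "\<lambda>_. \<mu>"]) auto
  qed
  have "2 ^ l * emeasure Q D = (\<Sum>J\<in>Pow {1..l}. emeasure Q D)"
    by (simp add: card_Pow)
  also have "\<dots> = (\<Sum>J\<in>Pow {1..l}. \<integral>\<^sup>+x. indicator D (T J x) \<partial>Q)"
  proof (rule sum.cong)
    fix J assume J: "J \<in> Pow {1..l}"
    have "emeasure Q D = (\<integral>\<^sup>+x. indicator D x \<partial>distr Q Q (T J))"
      using T(2)[OF J] by simp
    also have "\<dots> = (\<integral>\<^sup>+x. indicator D (T J x) \<partial>Q)"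
      by (rule nn_integral_distr[OF T(1)[OF J]]) measurable
    finally show "emeasure Q D = (\<integral>\<^sup>+x. indicator D (T J x) \<partial>Q)" .
  qed simp
  also have "\<dots> = (\<integral>\<^sup>+x. (\<Sum>J\<in>Pow {1..l}. indicator D (T J x)) \<partial>Q)"
    by (rule nn_integral_sum[symmetric]) (use T(1) in measurable)
  also have "\<dots> \<le> (\<integral>\<^sup>+x. ennreal c \<partial>Q)"
  proof (rule nn_integral_mono)
    fix x
    have dev: "two_sample_dev S l (T J x) = two_sample_dev S l (\<lambda>i. x (swap_halves l J i))" for J
      by (rule two_sample_dev_cong) (simp add: T_def)
    have "(\<Sum>J\<in>Pow {1..l}. indicator D (T J x) :: ennreal) = of_nat (card {J \<in> Pow {1..l}. T J x \<in> D})"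
      by (simp add: indicator_def sum.If_cases Int_def)
    also have "\<dots> = ennreal (real (card {J \<in> Pow {1..l}. T J x \<in> D}))"
      by (simp add: ennreal_of_nat_eq_real_of_nat)
    also have "\<dots> \<le> ennreal (real (card {J \<in> Pow {1..l}. two_sample_dev S l (\<lambda>i. x (swap_halves l J i)) > t}))"
      using D(2) unfolding dev[symmetric] by (intro ennreal_leI of_nat_mono card_mono) auto
    also have "\<dots> \<le> ennreal c"
      unfolding c_def by (intro ennreal_leI card_swaps_two_sample_dev_gt assms)
    finally show "(\<Sum>J\<in>Pow {1..l}. indicator D (T J x)) \<le> ennreal c" .
  qed
  also have "\<dots> = ennreal c"
    by (simp add: Q.emeasure_space_1)
  finally have "ennreal (2 ^ l * measure Q D) \<le> ennreal c"
    by (simp add: Q.emeasure_eq_measure ennreal_mult flip: ennreal_power)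
  then have "2 ^ l * measure Q D \<le> 2 ^ l * (2 * real (growth S (2 * l)) * exp (- (real l * t\<^sup>2 / 2)))"
    by (subst (asm) ennreal_le_iff) (auto simp: c_def mult_ac)
  then show ?thesis
    by (simp add: Q_def)
qed

lemma measure_rel_freq_deviation_le:
  assumes "prob_space \<mu>" "A \<in> sets \<mu>" "finite I" "I \<noteq> {}" "e \<ge> 0"
  shows "measure (Pi\<^sub>M I (\<lambda>_. \<mu>))
      {y \<in> space (Pi\<^sub>M I (\<lambda>_. \<mu>)). \<bar>(\<Sum>i\<in>I. indicator A (y i)) / real (card I) - measure \<mu> A\<bar> \<ge> e}
    \<le> 2 * exp (- (2 * real (card I) * e\<^sup>2))"
proof -
  define P where "P = Pi\<^sub>M I (\<lambda>_. \<mu>)"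
  have n: "card I > 0"
    using assms by (simp add: card_gt_0_iff)
  interpret P: prob_space P
    unfolding P_def by (intro prob_space_PiM assms(1))
  have comp: "(\<lambda>y. y i) \<in> measurable P \<mu>" "distr P \<mu> (\<lambda>y. y i) = \<mu>" if "i \<in> I" for i
    using that assms(1) by (auto simp: P_def intro!: distr_PiM_component)
  have "P.indep_vars (\<lambda>_. \<mu>) (\<lambda>i y. y i) I"
  proof (subst P.indep_vars_iff_distr_eq_PiM')
    have "distr P (Pi\<^sub>M I (\<lambda>_. \<mu>)) (\<lambda>x. restrict x I) = distr P P (\<lambda>x. x)"
      by (rule distr_cong) (auto simp: P_def space_PiM PiE_def extensional_restrict)
    also have "\<dots> = P"
      by simp
    also have "\<dots> = Pi\<^sub>M I (\<lambda>i. distr P \<mu> (\<lambda>y. y i))"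
      unfolding P_def by (rule PiM_cong) (use comp in \<open>auto simp: P_def\<close>)
    finally show "distr P (Pi\<^sub>M I (\<lambda>_. \<mu>)) (\<lambda>x. \<lambda>i\<in>I. x i) = Pi\<^sub>M I (\<lambda>i. distr P \<mu> (\<lambda>y. y i))" .
  qed (use comp assms in auto)
  then have indep: "P.indep_vars (\<lambda>_. borel) (\<lambda>i y. indicator A (y i) :: real) I"
    by (rule P.indep_vars_compose2) (use assms in measurable)
  have expect: "P.expectation (\<lambda>y. indicator A (y i)) = measure \<mu> A" if "i \<in> I" for i
  proof -
    have "P.expectation (\<lambda>y. indicator A (y i) :: real) = (\<integral>x. indicator A x \<partial>distr P \<mu> (\<lambda>y. y i))"
      by (rule integral_distr[symmetric]) (use comp[OF that] assms in auto)
    then show ?thesis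
      using comp[OF that] assms sets.sets_into_space by (auto simp: Int_absorb2)
  qed
  interpret H: Hoeffding_ineq P I "\<lambda>i y. indicator A (y i)" "\<lambda>_. 0" "\<lambda>_. 1"
    "\<Sum>i\<in>I. P.expectation (\<lambda>y. indicator A (y i))"
    by unfold_locales (use assms(3) in \<open>auto intro: indep\<close>)
  have mean: "(\<Sum>i\<in>I. P.expectation (\<lambda>y. indicator A (y i))) = real (card I) * measure \<mu> A"
    using expect by simp
  have "{y \<in> space P. \<bar>(\<Sum>i\<in>I. indicator A (y i)) / real (card I) - measure \<mu> A\<bar> \<ge> e}
    = {y \<in> space P. \<bar>(\<Sum>i\<in>I. indicator A (y i)) - real (card I) * measure \<mu> A\<bar> \<ge> real (card I) * e}"
  proof -
    have "\<bar>s / real (card I) - m\<bar> = \<bar>s - real (card I) * m\<bar> / real (card I)" for s m :: real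
    proof -
      have "s / real (card I) - m = (s - real (card I) * m) / real (card I)"
        using n by (simp add: diff_divide_distrib)
      then show ?thesis by simp
    qed
    then show ?thesis
      using n by (simp add: le_divide_eq mult.commute)
  qed
  then have "P.prob {y \<in> space P. \<bar>(\<Sum>i\<in>I. indicator A (y i)) / real (card I) - measure \<mu> A\<bar> \<ge> e}
    \<le> 2 * exp (- 2 * (real (card I) * e)\<^sup>2 / (\<Sum>i\<in>I. (1 - 0)\<^sup>2))"
    using H.Hoeffding_ineq_abs_ge[of "real (card I) * e"] n \<open>e \<ge> 0\<close> unfolding mean by simp
  also have "(real (card I) * e)\<^sup>2 = real (card I) * (real (card I) * e\<^sup>2)"
    by (simp add: power2_eq_square)
  finally show ?thesis
    using n unfolding P_def by (simp add: mult.assoc)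
qed

text \<open>
  The second half of the double sample is a ghost sample, independent of the first. When a set
  deviates by more than \<open>\<epsilon>\<close> on the first half, its frequency in the ghost sample is within
  \<open>\<epsilon> / 2\<close> of its probability with probability at least one half, by Hoeffding's inequality
  and because \<open>2 * exp (- 3 / 2) \<le> 1 / 2\<close>, and the halves then differ by more than \<open>\<epsilon> / 2\<close>.
  The set may depend on the first half, as the argument is carried out conditionally on it.
  The event of a large deviation is enclosed in a measurable one because it need not be measurable
  itself with respect to the product.
\<close>

lemma symmetrization:
  assumes "prob_space \<mu>" "S \<noteq> {}" "S \<subseteq> sets \<mu>" "l \<ge> 1" "\<epsilon> > 0" "3 \<le> real l * \<epsilon>\<^sup>2"
    and D: "D \<in> sets (Pi\<^sub>M {1..2 * l} (\<lambda>_. \<mu>))"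
      "\<And>x. x \<in> space (Pi\<^sub>M {1..2 * l} (\<lambda>_. \<mu>)) \<Longrightarrow> two_sample_dev S l x > \<epsilon> / 2 \<Longrightarrow> x \<in> D"
  obtains G where "G \<in> sets (Pi\<^sub>M {1..l} (\<lambda>_. \<mu>))"
    "\<And>x. x \<in> space (Pi\<^sub>M {1..l} (\<lambda>_. \<mu>)) \<Longrightarrow> max_dev \<mu> S l x > \<epsilon> \<Longrightarrow> x \<in> G"
    "measure (Pi\<^sub>M {1..l} (\<lambda>_. \<mu>)) G \<le> 2 * measure (Pi\<^sub>M {1..2 * l} (\<lambda>_. \<mu>)) D"
proof -
  interpret \<mu>: prob_space \<mu> by fact
  interpret product_sigma_finite "\<lambda>_::nat. \<mu>" by unfold_locales
  define I where "I = {1..l}"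
  define K where "K = {l + 1..2 * l}"
  define P where "P = Pi\<^sub>M I (\<lambda>_. \<mu>)"
  define P' where "P' = Pi\<^sub>M K (\<lambda>_. \<mu>)"
  have IK: "I \<inter> K = {}" "I \<union> K = {1..2 * l}" "finite I" "finite K"
    by (auto simp: I_def K_def)
  define Q where "Q = Pi\<^sub>M (I \<union> K) (\<lambda>_. \<mu>)"
  have Q_eq: "Q = Pi\<^sub>M {1..2 * l} (\<lambda>_. \<mu>)"
    by (simp add: Q_def IK)
  interpret P: prob_space P unfolding P_def by (intro prob_space_PiM assms(1))
  interpret P': prob_space P' unfolding P'_def by (intro prob_space_PiM assms(1))
  interpret Q: prob_space Q unfolding Q_def by (intro prob_space_PiM assms(1))
  have [measurable]: "D \<in> sets Q"
    using D(1) by (simp add: Q_eq)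
  have [measurable]: "(\<lambda>(x, y). merge I K (x, y)) \<in> measurable (P \<Otimes>\<^sub>M P') Q"
    unfolding P_def P'_def Q_def by simp
  define g where "g x = (\<integral>\<^sup>+y. indicator D (merge I K (x, y)) \<partial>P')" for x
  have g_meas[measurable]: "g \<in> borel_measurable P"
    unfolding g_def by measurable
  define G where "G = {x \<in> space P. g x \<ge> ennreal (1 / 2)}"
  have G_meas[measurable]: "G \<in> sets P"
    unfolding G_def by measurable
  have emeas_D: "emeasure Q D = (\<integral>\<^sup>+x. g x \<partial>P)"
    using product_nn_integral_fold[OF IK(1,3,4), of "indicator D"]
    by (simp add: g_def P_def P'_def Q_def[symmetric])
  show thesis
  proof (rule that[of G])
    show "G \<in> sets (Pi\<^sub>M {1..l} (\<lambda>_. \<mu>))"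
      using G_meas by (simp add: P_def I_def)
    have "ennreal (1 / 2) * emeasure P G = (\<integral>\<^sup>+x. ennreal (1 / 2) * indicator G x \<partial>P)"
      by (rule nn_integral_cmult_indicator[symmetric]) (rule G_meas)
    also have "\<dots> \<le> (\<integral>\<^sup>+x. g x \<partial>P)"
      by (rule nn_integral_mono) (auto simp: G_def indicator_def)
    finally have "ennreal (1 / 2 * P.prob G) \<le> ennreal (Q.prob D)"
      unfolding emeas_D[symmetric] P.emeasure_eq_measure Q.emeasure_eq_measure
      by (subst ennreal_mult) auto
    then show "measure (Pi\<^sub>M {1..l} (\<lambda>_. \<mu>)) G \<le> 2 * measure (Pi\<^sub>M {1..2 * l} (\<lambda>_. \<mu>)) D"
      by (subst (asm) ennreal_le_iff) (auto simp: P_def I_def Q_eq)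
  next
    fix x assume "x \<in> space (Pi\<^sub>M {1..l} (\<lambda>_. \<mu>))" and dev: "max_dev \<mu> S l x > \<epsilon>"
    then have x: "x \<in> space P"
      by (simp add: P_def I_def)
    obtain A where A: "A \<in> S" "\<bar>rel_freq x l A - measure \<mu> A\<bar> > \<epsilon>"
      using dev max_dev_gt_iff[OF assms(1,2)] by blast
    then have [measurable]: "A \<in> sets \<mu>"
      using assms(3) by auto
    define far where
      "far = {y \<in> space P'. \<bar>(\<Sum>i\<in>K. indicator A (y i)) / real (card K) - measure \<mu> A\<bar> \<ge> \<epsilon> / 2}"
    have card_K: "card K = l"
      by (simp add: K_def)
    have far_meas[measurable]: "far \<in> sets P'"
      unfolding far_def P'_def by measurable
    have "P'.prob far \<le> 2 * exp (- (2 * real (card K) * (\<epsilon> / 2)\<^sup>2))"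
      unfolding far_def P'_def using assms IK card_K \<open>A \<in> sets \<mu>\<close>
      by (intro measure_rel_freq_deviation_le) auto
    also have "\<dots> \<le> 2 * exp (- (3 / 2))"
      using assms(6) by (simp add: card_K power_divide)
    also have "\<dots> \<le> 1 / 2"
    proof -
      have "4 \<le> (1 + 1 / 2 + (1 / 2)\<^sup>2 / 2 :: real) ^ 3"
        by (simp add: power2_eq_square power3_eq_cube)
      also have "\<dots> \<le> exp (1 / 2) ^ 3"
        by (intro power_mono exp_lower_Taylor_quadratic) auto
      also have "\<dots> = exp (3 / 2)"
        by (simp flip: exp_of_nat_mult)
      finally show ?thesis
        by (simp add: exp_minus field_simps)
    qed
    finally have "1 / 2 \<le> P'.prob (space P' - far)"
      using P'.prob_compl[OF far_meas] by simp
    then have "ennreal (1 / 2) \<le> emeasure P' (space P' - far)"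
      unfolding P'.emeasure_eq_measure by (rule ennreal_leI)
    also have "\<dots> = (\<integral>\<^sup>+y. indicator (space P' - far) y \<partial>P')"
      by simp
    also have "\<dots> \<le> g x"
      unfolding g_def
    proof (rule nn_integral_mono)
      fix y assume y: "y \<in> space P'"
      have "merge I K (x, y) \<in> D" if "y \<notin> far"
      proof (rule D(2))
        show "merge I K (x, y) \<in> space (Pi\<^sub>M {1..2 * l} (\<lambda>_. \<mu>))"
          using x y IK(1) unfolding IK(2)[symmetric] by (auto simp: P_def P'_def space_PiM PiE_def)
        have "rel_freq (merge I K (x, y)) l A = rel_freq x l A"
          by (rule rel_freq_cong) (auto simp: merge_def I_def)
        moreover have "rel_freq (\<lambda>i. merge I K (x, y) (l + i)) l A = (\<Sum>i\<in>K. indicator A (y i)) / real (card K)"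
        proof -
          have "K = (+) l ` {1..l}"
            by (simp add: K_def mult_2)
          then have "(\<Sum>i\<in>K. indicator A (y i) :: real) = (\<Sum>i=1..l. indicator A (y (l + i)))"
            by (simp only: sum.reindex inj_on_add comp_def)
          also have "\<dots> = (\<Sum>i=1..l. indicator A (merge I K (x, y) (l + i)))"
            by (rule sum.cong) (auto simp: merge_def I_def K_def)
          finally show ?thesis
            by (simp add: rel_freq_def card_K)
        qed
        moreover have "\<bar>(\<Sum>i\<in>K. indicator A (y i)) / real (card K) - measure \<mu> A\<bar> < \<epsilon> / 2"
          using that y unfolding far_def by (auto simp only: mem_Collect_eq not_le)
        ultimately have "\<bar>rel_freq (merge I K (x, y)) l A - rel_freq (\<lambda>i. merge I K (x, y) (l + i)) l A\<bar> > \<epsilon> / 2"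
          using A(2) by linarith
        then show "two_sample_dev S l (merge I K (x, y)) > \<epsilon> / 2"
          using A(1) two_sample_dev_gt_iff[OF assms(2)] by blast
      qed
      then show "indicator (space P' - far) y \<le> (indicator D (merge I K (x, y)) :: ennreal)"
        by (auto simp: indicator_def)
    qed
    finally show "x \<in> G"
      using x by (simp add: G_def)
  qed
qed

text \<open>
  The threshold \<open>3 \<le> l * \<epsilon>\<^sup>2\<close> of the symmetrization costs nothing: below it the right-hand side
  exceeds one. The completed product space enters only through a measurable kernel and a measurable
  hull of the two-sample event that differ by a null set.
\<close>

theorem Vapnik_Chervonenkis_inequality:
  assumes "prob_space M" "prob_space.indep_vars M (\<lambda>_. N) X {1..}"
    and distr: "\<And>i. i \<ge> 1 \<Longrightarrow> distr M N (X i) = \<mu>"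
    and "S \<noteq> {}" "S \<subseteq> sets N" "l \<ge> 1" "\<epsilon> > 0"
    and meas: "two_sample_dev S l \<in> borel_measurable (completion (Pi\<^sub>M {1..2 * l} (\<lambda>_. \<mu>)))"
  shows "measure M {\<omega> \<in> space M. max_dev \<mu> S l (\<lambda>i. X i \<omega>) > \<epsilon>}
    \<le> 4 * real (growth S (2 * l)) * exp (- (\<epsilon>\<^sup>2 * real l / 8))"
proof -
  interpret M: prob_space M by fact
  have rv: "X i \<in> measurable M N" if "i \<ge> 1" for i
    using assms(2) that by (auto simp: M.indep_vars_def)
  have "prob_space (distr M N (X 1))"
    by (intro M.prob_space_distr rv) simp
  then have \<mu>: "prob_space \<mu>"
    by (simp add: distr)
  have sets_\<mu>: "sets \<mu> = sets N"
    using distr[of 1] by (metis order_refl sets_distr)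
  show ?thesis
  proof (cases "3 \<le> real l * \<epsilon>\<^sup>2")
    case False
    have "1 / 4 \<le> exp (- (3 / 8) :: real)"
      using exp_ge_add_one_self[of "- (3 / 8) :: real"] by linarith
    also have "\<dots> \<le> exp (- (\<epsilon>\<^sup>2 * real l / 8))"
      using False by (simp add: mult.commute)
    finally have "1 \<le> 4 * 1 * exp (- (\<epsilon>\<^sup>2 * real l / 8))"
      by simp
    also have "\<dots> \<le> 4 * real (growth S (2 * l)) * exp (- (\<epsilon>\<^sup>2 * real l / 8))"
      using growth_pos[OF \<open>S \<noteq> {}\<close>, of "2 * l"] by (intro mult_right_mono) auto
    finally show ?thesis
      using M.prob_le_1 order_trans by blast
  next
    case True
    define Q where "Q = Pi\<^sub>M {1..2 * l} (\<lambda>_. \<mu>)"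
    define P where "P = Pi\<^sub>M {1..l} (\<lambda>_. \<mu>)"
    interpret Q: prob_space Q unfolding Q_def by (intro prob_space_PiM \<mu>)
    define E where "E = {x \<in> space Q. two_sample_dev S l x > \<epsilon> / 2}"
    have "E = {x \<in> space (completion Q). two_sample_dev S l x > \<epsilon> / 2}"
      by (simp add: E_def)
    also have "\<dots> \<in> sets (completion Q)"
      using meas unfolding Q_def by measurable
    finally have E: "E \<in> sets (completion Q)" .
    define D0 where "D0 = main_part Q E"
    obtain Z where Z: "Z \<in> null_sets Q" "null_part Q E \<subseteq> Z"
      using null_part[OF E] by blast
    have D0: "D0 \<in> sets Q"
      unfolding D0_def by (rule main_part_sets[OF E])
    have E_eq: "D0 \<union> null_part Q E = E"
      unfolding D0_def by (rule main_part_null_part_Un[OF E])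
    obtain G where G: "G \<in> sets P" "\<And>x. x \<in> space P \<Longrightarrow> max_dev \<mu> S l x > \<epsilon> \<Longrightarrow> x \<in> G"
      "measure P G \<le> 2 * measure Q (D0 \<union> Z)"
    proof (rule symmetrization[OF \<mu> \<open>S \<noteq> {}\<close> _ \<open>l \<ge> 1\<close> \<open>\<epsilon> > 0\<close> True, of "D0 \<union> Z"])
      show "S \<subseteq> sets \<mu>"
        using assms(5) by (simp add: sets_\<mu>)
      show "D0 \<union> Z \<in> sets (Pi\<^sub>M {1..2 * l} (\<lambda>_. \<mu>))"
        using D0 Z(1) unfolding Q_def by auto
      fix x assume "x \<in> space (Pi\<^sub>M {1..2 * l} (\<lambda>_. \<mu>))" "two_sample_dev S l x > \<epsilon> / 2"
      then have "x \<in> E"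
        by (simp add: E_def Q_def)
      then show "x \<in> D0 \<union> Z"
        using E_eq Z(2) by blast
    qed (auto simp: P_def Q_def)
    define Y where "Y \<omega> = (\<lambda>i\<in>{1..l}. X i \<omega>)" for \<omega>
    have indep: "M.indep_vars (\<lambda>_. N) X {1..l}"
      using assms(2) by (rule M.indep_vars_subset) auto
    have "distr M (Pi\<^sub>M {1..l} (\<lambda>_. N)) Y = Pi\<^sub>M {1..l} (\<lambda>i. distr M N (X i))"
      unfolding Y_def using indep rv \<open>l \<ge> 1\<close> by (subst (asm) M.indep_vars_iff_distr_eq_PiM') auto
    also have "\<dots> = P"
      unfolding P_def by (rule PiM_cong) (auto simp: distr)
    finally have distr_Y: "distr M (Pi\<^sub>M {1..l} (\<lambda>_. N)) Y = P" .
    have Y: "Y \<in> measurable M (Pi\<^sub>M {1..l} (\<lambda>_. N))"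
      unfolding Y_def by (intro measurable_restrict rv) auto
    have sets_P: "sets P = sets (Pi\<^sub>M {1..l} (\<lambda>_. N))" and space_P: "space P = space (Pi\<^sub>M {1..l} (\<lambda>_. N))"
      unfolding distr_Y[symmetric] by simp_all
    have dev_Y: "max_dev \<mu> S l (Y \<omega>) = max_dev \<mu> S l (\<lambda>i. X i \<omega>)" for \<omega>
    proof -
      have "rel_freq (Y \<omega>) l A = rel_freq (\<lambda>i. X i \<omega>) l A" for A
        by (rule rel_freq_cong) (simp add: Y_def)
      then show ?thesis
        by (simp add: max_dev_def)
    qed
    have "measure M {\<omega> \<in> space M. max_dev \<mu> S l (\<lambda>i. X i \<omega>) > \<epsilon>} \<le> measure M (Y -` G \<inter> space M)"
    proof (rule M.finite_measure_mono)
      show "{\<omega> \<in> space M. max_dev \<mu> S l (\<lambda>i. X i \<omega>) > \<epsilon>} \<subseteq> Y -` G \<inter> space M"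
        using G(2) measurable_space[OF Y] by (auto simp: dev_Y space_P)
      show "Y -` G \<inter> space M \<in> sets M"
        using Y G(1) by (auto simp: sets_P)
    qed
    also have "\<dots> = measure P G"
      using measure_distr[OF Y, of G] G(1) unfolding distr_Y sets_P by simp
    also have "\<dots> \<le> 2 * measure Q (D0 \<union> Z)"
      by (rule G(3))
    also have "measure Q (D0 \<union> Z) = measure Q D0"
      using D0 Z(1) by (rule measure_Un_null_set)
    also have "\<dots> \<le> 2 * real (growth S (2 * l)) * exp (- (real l * (\<epsilon> / 2)\<^sup>2 / 2))"
      unfolding Q_def
    proof (rule measure_two_sample_dev_le[OF \<mu> \<open>S \<noteq> {}\<close> \<open>l \<ge> 1\<close>])
      show "D0 \<in> sets (Pi\<^sub>M {1..2 * l} (\<lambda>_. \<mu>))"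
        using D0 by (simp add: Q_def)
      show "two_sample_dev S l x > \<epsilon> / 2" if "x \<in> D0" for x
        using that E_eq by (auto simp: E_def)
    qed (use \<open>\<epsilon> > 0\<close> in simp)
    also have "2 * (2 * real (growth S (2 * l)) * exp (- (real l * (\<epsilon> / 2)\<^sup>2 / 2)))
      = 4 * real (growth S (2 * l)) * exp (- (\<epsilon>\<^sup>2 * real l / 8))"
      by (simp add: power_divide mult.commute)
    finally show ?thesis by simp
  qed
qed

section \<open>The number of exceedances\<close>

text \<open>
  If no deviation of index \<open>k\<close> or above exceeds \<open>\<epsilon>\<close>, only the indices \<open>1, \<dots>, k - 1\<close> can be
  counted.
\<close>

lemma num_exceed_geD:
  assumes "num_exceed \<epsilon> d \<ge> enat k" "k \<ge> 1"
  shows "\<exists>l\<ge>k. d l > \<epsilon>"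
proof (rule ccontr)
  assume "\<not> (\<exists>l\<ge>k. d l > \<epsilon>)"
  then have le: "d l \<le> \<epsilon>" if "l \<ge> k" for l
    using that by (meson not_less)
  have "num_exceed \<epsilon> d = (\<Sum>l<k - 1. if d (Suc l) > \<epsilon> then 1 else 0)"
    unfolding num_exceed_def
  proof (rule suminf_finite)
    fix l assume "l \<notin> {..<k - 1}"
    then have "d (Suc l) \<le> \<epsilon>"
      by (intro le) auto
    then show "(if d (Suc l) > \<epsilon> then 1 else 0) = (0 :: enat)" by simp
  qed simp
  also have "\<dots> \<le> (\<Sum>l<k - 1. 1)"
    by (rule sum_mono) auto
  also have "\<dots> = enat (k - 1)"
    by (simp add: of_nat_eq_enat)
  finally have "enat k \<le> enat (k - 1)"
    using assms(1) by (rule order_trans[rotated])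
  then show False
    using \<open>k \<ge> 1\<close> by simp
qed

lemma summable_growth_times_exp:
  assumes "\<And>l. l \<ge> 1 \<Longrightarrow> real (growth S l) \<le> real l powr p + 1" "c > 0"
  shows "summable (\<lambda>l. real (growth S (2 * l)) * exp (- (c * real l)))"
proof (rule summable_comparison_test_bigo)
  have "summable (\<lambda>l. exp (- (c / 2)) ^ l)"
    using \<open>c > 0\<close> by (intro summable_geometric) simp
  then show "summable (\<lambda>l. norm (exp (- (c / 2 * real l))))"
    by (simp add: mult.commute flip: exp_of_nat_mult)
  have "(\<lambda>l. real (growth S (2 * l)) * exp (- (c * real l)))
    \<in> O(\<lambda>l. ((2 * real l) powr p + 1) * exp (- (c * real l)))"
  proof (rule bigoI[of _ 1], rule eventually_mono[OF eventually_ge_at_top[of 1]])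
    fix l :: nat assume "l \<ge> 1"
    then have "real (growth S (2 * l)) \<le> (2 * real l) powr p + 1"
      using assms(1)[of "2 * l"] by simp
    moreover have "0 \<le> (2 * real l) powr p" by simp
    ultimately show "norm (real (growth S (2 * l)) * exp (- (c * real l)))
      \<le> 1 * norm (((2 * real l) powr p + 1) * exp (- (c * real l)))"
      by (simp add: abs_mult)
  qed
  also have "(\<lambda>l. ((2 * real l) powr p + 1) * exp (- (c * real l))) \<in> O(\<lambda>l. exp (- (c / 2 * real l)))"
    using \<open>c > 0\<close> by real_asymp
  finally show "(\<lambda>l. real (growth S (2 * l)) * exp (- (c * real l))) \<in> O(\<lambda>l. exp (- (c / 2 * real l)))" .
qed

text \<open>
  Submultiplicativity of the growth function makes the tail of the series from \<open>k\<close> on at most a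
  constant times its \<open>k\<close>-th term. This is why \<open>\<Lambda>\<close> can carry the exponent of the
  Vapnik--Chervonenkis bound without loss.
\<close>

lemma (in prob_space) prob_exceeds_after_le:
  fixes d :: "nat \<Rightarrow> 'a \<Rightarrow> real"
  assumes meas: "\<And>l. l \<ge> 1 \<Longrightarrow> d l \<in> borel_measurable M"
    and bound: "\<And>l. l \<ge> 1 \<Longrightarrow> prob {\<omega> \<in> space M. d l \<omega> > \<epsilon>}
        \<le> 4 * real (growth S (2 * l)) * exp (- (c * real l))"
    and summable: "summable (\<lambda>l. real (growth S (2 * l)) * exp (- (c * real l)))"
    and "k \<ge> 1"
  shows "prob (\<Union>j. {\<omega> \<in> space M. d (k + j) \<omega> > \<epsilon>})
    \<le> (\<Sum>l. 4 * (real (growth S (2 * l)) * exp (- (c * real l)))) * (real (growth S (2 * k)) * exp (- (c * real k)))"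
proof -
  define b where "b l = real (growth S (2 * l)) * exp (- (c * real l))" for l
  define E where "E j = {\<omega> \<in> space M. d (k + j) \<omega> > \<epsilon>}" for j
  have E_meas: "E j \<in> events" for j
  proof -
    have [measurable]: "d (k + j) \<in> borel_measurable M"
      using \<open>k \<ge> 1\<close> by (intro meas) simp
    show ?thesis
      unfolding E_def by measurable
  qed
  have b_sub: "b (k + j) \<le> b k * b j" for j
  proof -
    have "real (growth S (2 * (k + j))) \<le> real (growth S (2 * k)) * real (growth S (2 * j))"
      using growth_add_le[of S "2 * k" "2 * j"] by (simp add: distrib_left flip: of_nat_mult)
    then have "b (k + j) \<le> real (growth S (2 * k)) * real (growth S (2 * j)) * exp (- (c * real (k + j)))"
      unfolding b_def by (rule mult_right_mono) simp
    also have "exp (- (c * real (k + j))) = exp (- (c * real k)) * exp (- (c * real j))"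
      by (simp add: algebra_simps flip: exp_add)
    finally show ?thesis
      by (simp add: b_def mult_ac)
  qed
  have E_le: "prob (E j) \<le> b k * (4 * b j)" for j
  proof -
    have "prob (E j) \<le> 4 * b (k + j)"
      using bound[of "k + j"] \<open>k \<ge> 1\<close> by (simp add: E_def b_def mult.assoc)
    also have "\<dots> \<le> 4 * (b k * b j)"
      using b_sub by simp
    finally show ?thesis by simp
  qed
  have sum: "summable (\<lambda>j. b k * (4 * b j))"
    using summable unfolding b_def[symmetric] by (intro summable_mult)
  then have sum_E: "summable (\<lambda>j. prob (E j))"
    by (rule summable_comparison_test'[where N = 0]) (use E_le in simp)
  have "prob (\<Union>j. E j) \<le> (\<Sum>j. prob (E j))"
    using E_meas sum_E by (intro finite_measure_subadditive_countably) auto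
  also have "\<dots> \<le> (\<Sum>j. b k * (4 * b j))"
    by (rule suminf_le[OF E_le sum_E sum])
  also have "\<dots> = b k * (\<Sum>j. 4 * b j)"
    using summable unfolding b_def[symmetric] by (intro suminf_mult summable_mult)
  finally show ?thesis
    by (simp add: E_def b_def mult.commute)
qed

theorem theorem5:
  fixes M :: "'a measure" and \<mu> :: "(real ^ 'd) measure"
    and X :: "nat \<Rightarrow> 'a \<Rightarrow> real ^ 'd" and S :: "(real ^ 'd) set set" and p :: real
  assumes "prob_space M"
    and "prob_space.indep_vars M (\<lambda>_. borel) X {1..}"
    and "\<And>i. i \<ge> 1 \<Longrightarrow> distr M borel (X i) = \<mu>"
    and "S \<noteq> {}" and "S \<subseteq> sets borel"
    and "p > 0" and "\<And>l. l \<ge> 1 \<Longrightarrow> real (growth S l) \<le> real l powr p + 1"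
    and "\<And>l. l \<ge> 1 \<Longrightarrow> (\<lambda>\<omega>. max_dev \<mu> S l (\<lambda>i. X i \<omega>)) \<in> borel_measurable M"
    and "\<And>l. l \<ge> 1 \<Longrightarrow>
      two_sample_dev S l \<in> borel_measurable (completion (Pi\<^sub>M {1..2 * l} (\<lambda>_. \<mu>)))"
  shows "(AE \<omega> in M. (\<lambda>l. max_dev \<mu> S l (\<lambda>i. X i \<omega>)) \<longlonglongrightarrow> 0) \<and>
    (\<forall>\<epsilon>>0. \<forall>\<delta>>0.
      (\<integral>\<^sup>+\<omega>. \<Lambda>_ext S \<epsilon> \<delta> (num_exceed \<epsilon> (\<lambda>l. max_dev \<mu> S l (\<lambda>i. X i \<omega>))) \<partial>M) < \<infinity>) \<and>
    (\<forall>\<epsilon>>0. \<forall>\<delta>>0. \<exists>C>0. \<forall>k\<ge>1.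
      measure M {\<omega> \<in> space M. num_exceed \<epsilon> (\<lambda>l. max_dev \<mu> S l (\<lambda>i. X i \<omega>)) \<ge> enat k}
        \<le> C / \<Lambda> S \<epsilon> \<delta> k)"
proof -
  interpret prob_space M by fact
  define d where "d l \<omega> = max_dev \<mu> S l (\<lambda>i. X i \<omega>)" for l \<omega>
  define b where "b \<epsilon> l = real (growth S (2 * l)) * exp (- (\<epsilon>\<^sup>2 / 8 * real l))" for \<epsilon> l
  define C where "C \<epsilon> = (\<Sum>l. 4 * b \<epsilon> l)" for \<epsilon>
  define U where "U \<epsilon> k = (\<Union>j. {\<omega> \<in> space M. d (k + j) \<omega> > \<epsilon>})" for \<epsilon> k
  have "X 1 \<in> borel_measurable M"
    using assms(2) by (auto simp: indep_vars_def)
  then have \<mu>: "prob_space \<mu>"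
    using prob_space_distr[of "X 1" borel] assms(3)[of 1] by simp
  have d_meas: "d l \<in> borel_measurable M" if "l \<ge> 1" for l
    using assms(8)[OF that] unfolding d_def .
  have VC: "prob {\<omega> \<in> space M. d l \<omega> > \<epsilon>} \<le> 4 * b \<epsilon> l" if "l \<ge> 1" "\<epsilon> > 0" for l \<epsilon>
    using Vapnik_Chervonenkis_inequality[OF assms(1-5) that assms(9)[OF that(1)]]
    by (simp add: d_def b_def mult.assoc)
  have summable_b: "summable (b \<epsilon>)" if "\<epsilon> > 0" for \<epsilon>
    unfolding b_def using assms(7) that by (intro summable_growth_times_exp) auto
  have C_pos: "C \<epsilon> > 0" if "\<epsilon> > 0" for \<epsilon>
    unfolding C_def
  proof (rule suminf_pos)
    show "summable (\<lambda>l. 4 * b \<epsilon> l)"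
      by (intro summable_mult summable_b that)
    show "0 < 4 * b \<epsilon> l" for l
      using growth_pos[OF \<open>S \<noteq> {}\<close>] by (simp add: b_def)
  qed
  have U_meas: "U \<epsilon> k \<in> events" if "k \<ge> 1" for \<epsilon> k
  proof -
    have "{\<omega> \<in> space M. d (k + j) \<omega> > \<epsilon>} \<in> events" for j
    proof -
      have [measurable]: "d (k + j) \<in> borel_measurable M"
        using that by (intro d_meas) simp
      show ?thesis
        by measurable
    qed
    then show ?thesis
      unfolding U_def by auto
  qed
  have U_le: "prob (U \<epsilon> k) \<le> C \<epsilon> * b \<epsilon> k" if "\<epsilon> > 0" "k \<ge> 1" for \<epsilon> k
    unfolding U_def C_def b_def
  proof (rule prob_exceeds_after_le)
    show "summable (\<lambda>l. real (growth S (2 * l)) * exp (- (\<epsilon>\<^sup>2 / 8 * real l)))"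
      using summable_b[OF \<open>\<epsilon> > 0\<close>] unfolding b_def .
  qed (use d_meas VC that in \<open>auto simp: b_def mult.assoc\<close>)
  have U_exceed: "\<omega> \<in> U \<epsilon> k"
    if \<omega>: "\<omega> \<in> space M" and k: "num_exceed \<epsilon> (\<lambda>l. d l \<omega>) \<ge> enat k" "k \<ge> 1" for \<omega> \<epsilon> k
  proof -
    obtain l where "l \<ge> k" "d l \<omega> > \<epsilon>"
      using num_exceed_geD[OF k] by blast
    then show ?thesis
      using \<omega> unfolding U_def by (auto intro!: exI[of _ "l - k"])
  qed
  have \<Lambda>_b: "\<Lambda> S \<epsilon> \<delta> k * b \<epsilon> k = real k powr (- (1 + \<delta>))" if "k \<ge> 1" for \<epsilon> \<delta> k
  proof -
    have "\<Lambda> S \<epsilon> \<delta> k * b \<epsilon> k = 1 / real k powr (1 + \<delta>)"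
      using that growth_pos[OF \<open>S \<noteq> {}\<close>, of "2 * k"]
      by (simp add: \<Lambda>_def b_def exp_minus field_simps)
    then show ?thesis
      by (simp only: powr_minus_divide)
  qed
  have \<Lambda>_pos: "\<Lambda> S \<epsilon> \<delta> k > 0" if "k \<ge> 1" for \<epsilon> \<delta> k
    using that growth_pos[OF \<open>S \<noteq> {}\<close>, of "2 * k"] by (simp add: \<Lambda>_def)

  have eventually_le: "AE \<omega> in M. \<forall>\<^sub>F l in sequentially. d l \<omega> \<le> \<epsilon>" if "\<epsilon> > 0" for \<epsilon>
  proof -
    have "AE \<omega> in M. \<forall>\<^sub>F n in sequentially. \<omega> \<in> space M - {\<omega> \<in> space M. d (Suc n) \<omega> > \<epsilon>}"
    proof (rule borel_cantelli_AE1)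
      show "{\<omega> \<in> space M. d (Suc n) \<omega> > \<epsilon>} \<in> events" for n
      proof -
        have [measurable]: "d (Suc n) \<in> borel_measurable M"
          by (intro d_meas) simp
        show ?thesis
          by measurable
      qed
      show "emeasure M {\<omega> \<in> space M. d (Suc n) \<omega> > \<epsilon>} < \<infinity>" for n
        by (simp add: emeasure_eq_measure)
      show "summable (\<lambda>n. prob {\<omega> \<in> space M. d (Suc n) \<omega> > \<epsilon>})"
      proof (rule summable_comparison_test'[where N = 0])
        show "summable (\<lambda>n. 4 * b \<epsilon> (Suc n))"
          using summable_b[OF that] by (intro summable_mult) (simp add: summable_Suc_iff)
      qed (use VC that in auto)
    qed
    then show ?thesis
    proof eventually_elim
      case (elim \<omega>)
      then have "\<forall>\<^sub>F n in sequentially. d (Suc n) \<omega> \<le> \<epsilon>"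
        by (rule eventually_mono) auto
      then show ?case
        by (rule eventually_sequentially_Suc[THEN iffD1])
    qed
  qed
  have conv: "AE \<omega> in M. (\<lambda>l. d l \<omega>) \<longlonglongrightarrow> 0"
  proof -
    have "AE \<omega> in M. \<forall>n. \<forall>\<^sub>F l in sequentially. d l \<omega> \<le> 1 / real (Suc n)"
      unfolding AE_all_countable using eventually_le by simp
    then show ?thesis
    proof eventually_elim
      case (elim \<omega>)
      show ?case
      proof (rule tendstoI)
        fix e :: real assume "e > 0"
        then obtain n where n: "1 / real (Suc n) < e"
          using nat_approx_posE by blast
        show "\<forall>\<^sub>F l in sequentially. dist (d l \<omega>) 0 < e"
          using elim[rule_format, of n]
        proof eventually_elim
          case (elim l)
          then show ?case
            using n max_dev_nonneg[OF \<mu> \<open>S \<noteq> {}\<close>] by (simp add: d_def)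
        qed
      qed
    qed
  qed
  have expectation: "(\<integral>\<^sup>+\<omega>. \<Lambda>_ext S \<epsilon> \<delta> (num_exceed \<epsilon> (\<lambda>l. d l \<omega>)) \<partial>M) < \<infinity>"
    if "\<epsilon> > 0" "\<delta> > 0" for \<epsilon> \<delta>
  proof -
    have "(\<integral>\<^sup>+\<omega>. \<Lambda>_ext S \<epsilon> \<delta> (num_exceed \<epsilon> (\<lambda>l. d l \<omega>)) \<partial>M)
      \<le> (\<integral>\<^sup>+\<omega>. (\<Sum>k. ennreal (\<Lambda> S \<epsilon> \<delta> (Suc k)) * indicator (U \<epsilon> (Suc k)) \<omega>) \<partial>M)"
      \<comment> \<open>The term whose index is the number of exceedances already equals the left-hand side. An
        infinite number has to be excluded first, as there the left-hand side is infinite.\<close>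
    proof (rule nn_integral_mono_AE)
      show "AE \<omega> in M. \<Lambda>_ext S \<epsilon> \<delta> (num_exceed \<epsilon> (\<lambda>l. d l \<omega>))
        \<le> (\<Sum>k. ennreal (\<Lambda> S \<epsilon> \<delta> (Suc k)) * indicator (U \<epsilon> (Suc k)) \<omega>)"
        using eventually_le[OF \<open>\<epsilon> > 0\<close>] AE_space
      proof eventually_elim
        case (elim \<omega>)
        obtain K where K: "\<And>l. l \<ge> K \<Longrightarrow> d l \<omega> \<le> \<epsilon>"
          using elim(1) unfolding eventually_sequentially by blast
        have "num_exceed \<epsilon> (\<lambda>l. d l \<omega>) \<noteq> \<infinity>"
        proof
          assume "num_exceed \<epsilon> (\<lambda>l. d l \<omega>) = \<infinity>"
          then obtain l where "l \<ge> Suc K" "d l \<omega> > \<epsilon>"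
            using num_exceed_geD[of "Suc K" \<epsilon> "\<lambda>l. d l \<omega>"] by auto
          then show False
            using K[of l] by simp
        qed
        then obtain N where N: "num_exceed \<epsilon> (\<lambda>l. d l \<omega>) = enat N"
          by auto
        show ?case
        proof (cases N)
          case 0
          then show ?thesis
            by (simp add: N \<Lambda>_ext_def \<Lambda>_def)
        next
          case (Suc k)
          define h where "h i = ennreal (\<Lambda> S \<epsilon> \<delta> (Suc i)) * indicator (U \<epsilon> (Suc i)) \<omega>" for i
          have "\<Lambda>_ext S \<epsilon> \<delta> (num_exceed \<epsilon> (\<lambda>l. d l \<omega>)) = h k"
            using U_exceed[OF elim(2), of "Suc k" \<epsilon>] by (simp add: N Suc \<Lambda>_ext_def h_def)
          also have "\<dots> \<le> (\<Sum>i. h i)"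
            using sum_le_suminf[of h "{k}"] by simp
          finally show ?thesis
            unfolding h_def .
        qed
      qed
    qed
    also have "\<dots> = (\<Sum>k. \<integral>\<^sup>+\<omega>. ennreal (\<Lambda> S \<epsilon> \<delta> (Suc k)) * indicator (U \<epsilon> (Suc k)) \<omega> \<partial>M)"
      using U_meas by (intro nn_integral_suminf) auto
    also have "\<dots> = (\<Sum>k. ennreal (\<Lambda> S \<epsilon> \<delta> (Suc k) * prob (U \<epsilon> (Suc k))))"
      using U_meas \<Lambda>_pos by (intro suminf_cong)
        (simp add: nn_integral_cmult_indicator emeasure_eq_measure ennreal_mult less_imp_le)
    also have "\<dots> \<le> (\<Sum>k. ennreal (C \<epsilon> * real (Suc k) powr (- (1 + \<delta>))))"
    proof (intro suminf_le ennreal_leI)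
      fix k
      have "\<Lambda> S \<epsilon> \<delta> (Suc k) * prob (U \<epsilon> (Suc k)) \<le> \<Lambda> S \<epsilon> \<delta> (Suc k) * (C \<epsilon> * b \<epsilon> (Suc k))"
        using U_le[OF \<open>\<epsilon> > 0\<close>, of "Suc k"] \<Lambda>_pos[of "Suc k" \<epsilon> \<delta>] by (intro mult_left_mono) auto
      also have "\<dots> = C \<epsilon> * real (Suc k) powr (- (1 + \<delta>))"
        using \<Lambda>_b[of "Suc k" \<epsilon> \<delta>] by (simp only: mult.left_commute[of _ "C \<epsilon>"])
      finally show "\<Lambda> S \<epsilon> \<delta> (Suc k) * prob (U \<epsilon> (Suc k)) \<le> C \<epsilon> * real (Suc k) powr (- (1 + \<delta>))" .
    qed auto
    also have "\<dots> < \<infinity>"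
    proof -
      have "summable (\<lambda>k. real k powr (- (1 + \<delta>)))"
        using \<open>\<delta> > 0\<close> by (simp add: summable_real_powr_iff)
      then have "summable (\<lambda>k. C \<epsilon> * real (Suc k) powr (- (1 + \<delta>)))"
        by (intro summable_mult) (rule summable_Suc_iff[THEN iffD2])
      then show ?thesis
        using C_pos[OF \<open>\<epsilon> > 0\<close>] by (subst suminf_ennreal2) auto
    qed
    finally show ?thesis .
  qed
  have tail: "prob {\<omega> \<in> space M. num_exceed \<epsilon> (\<lambda>l. d l \<omega>) \<ge> enat k} \<le> C \<epsilon> / \<Lambda> S \<epsilon> \<delta> k"
    if "\<epsilon> > 0" "\<delta> > 0" "k \<ge> 1" for \<epsilon> \<delta> k
  proof -
    have "prob {\<omega> \<in> space M. num_exceed \<epsilon> (\<lambda>l. d l \<omega>) \<ge> enat k} \<le> prob (U \<epsilon> k)"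
      using U_exceed that U_meas by (intro finite_measure_mono) auto
    also have "\<dots> \<le> C \<epsilon> * b \<epsilon> k"
      using U_le that by simp
    also have "\<dots> \<le> C \<epsilon> / \<Lambda> S \<epsilon> \<delta> k"
    proof -
      have "\<Lambda> S \<epsilon> \<delta> k * b \<epsilon> k \<le> 1"
        using that powr_mono[of "- (1 + \<delta>)" 0 "real k"] by (simp add: \<Lambda>_b)
      then have "b \<epsilon> k \<le> 1 / \<Lambda> S \<epsilon> \<delta> k"
        using \<Lambda>_pos[OF \<open>k \<ge> 1\<close>, of \<epsilon> \<delta>] by (simp add: le_divide_eq mult.commute)
      then show ?thesis
        using mult_left_mono[of _ _ "C \<epsilon>"] C_pos[OF \<open>\<epsilon> > 0\<close>] by fastforce
    qed
    finally show ?thesis .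
  qed
  show ?thesis
  proof (intro conjI allI impI)
    show "AE \<omega> in M. (\<lambda>l. max_dev \<mu> S l (\<lambda>i. X i \<omega>)) \<longlonglongrightarrow> 0"
      using conv unfolding d_def .
  next
    fix \<epsilon> \<delta> :: real assume "\<epsilon> > 0" "\<delta> > 0"
    then show "(\<integral>\<^sup>+\<omega>. \<Lambda>_ext S \<epsilon> \<delta> (num_exceed \<epsilon> (\<lambda>l. max_dev \<mu> S l (\<lambda>i. X i \<omega>))) \<partial>M) < \<infinity>"
      using expectation unfolding d_def by blast
  next
    fix \<epsilon> \<delta> :: real assume "\<epsilon> > 0" "\<delta> > 0"
    then show "\<exists>C>0. \<forall>k\<ge>1.
      prob {\<omega> \<in> space M. num_exceed \<epsilon> (\<lambda>l. max_dev \<mu> S l (\<lambda>i. X i \<omega>)) \<ge> enat k} \<le> C / \<Lambda> S \<epsilon> \<delta> k"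
      using C_pos tail unfolding d_def by (intro exI[of _ "C \<epsilon>"]) simp
  qed
qed

end
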